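(* Let $\mathcal{B}$ be a nondegenerate commutative $2$-cocycle on a compatible Lie algebra $(\mathfrak{g},[-,-]_1,[-,-]_2)$. Then there exists a structure of a compatible anti-pre-Lie algebra $(\mathfrak{g},\circ,\ast)$ on $(\mathfrak{g},[-,-]_1,[-,-]_2)$ given by $$\mathcal{B}(x\circ y,z)=\mathcal{B}(y,[x,z]_1),\qquad \mathcal{B}(x\ast y,z)=\mathcal{B}(y,[x,z]_2),\qquad \forall x,y,z\in\mathfrak{g}.$$
   Context: All vector spaces and algebras are finite-dimensional over $\mathbb{C}$. An anti-pre-Lie algebra is a vector space $A$ with a bilinear operation $\cdot$ such that, with $[x,y]=x\cdot y-y\cdot x$, for all $x,y,z\in A$: $x\cdot(y\cdot z)-y\cdot(x\cdot z)=[y,x]\cdot z$ and $[x,y]\cdot z+[y,z]\cdot x+[z,x]\cdot y=0$. $(A,\circ,\ast)$ is a compatible anti-pre-Lie algebra if $(A,\circ)$ and $(A,\ast)$ are anti-pre-Lie algebras and for all $k_1,k_2\in\mathbb{C}$ the operation $k_1x\circ y+k_2x\ast y$ makes $A$ an anti-pre-Lie algebra. A compatible Lie algebra $(\mathfrak{g},[-,-]_1,[-,-]_2)$ is a vector space with two Lie brackets such that $k_1[-,-]_1+k_2[-,-]_2$ is a Lie bracket for all $k_1,k_2\in\mathbb{C}$. A structure of a compatible anti-pre-Lie algebra on $(\mathfrak{g},[-,-]_1,[-,-]_2)$ is a compatible anti-pre-Lie algebra $(\mathfrak{g},\circ,\ast)$ on the same vector space with $[x,y]_1=x\circ y-y\circ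 x$ and $[x,y]_2=x\ast y-y\ast x$ for all $x,y\in\mathfrak{g}$. A commutative $2$-cocycle on a Lie algebra $(\mathfrak{g},[-,-])$ is a symmetric bilinear form $\mathcal{B}$ with $\mathcal{B}([x,y],z)+\mathcal{B}([y,z],x)+\mathcal{B}([z,x],y)=0$ for all $x,y,z\in\mathfrak{g}$; a commutative $2$-cocycle on a compatible Lie algebra $(\mathfrak{g},[-,-]_1,[-,-]_2)$ is a symmetric bilinear form that is a commutative $2$-cocycle on $(\mathfrak{g},k_1[-,-]_1+k_2[-,-]_2)$ for all $k_1,k_2\in\mathbb{C}$. *)

theory Defs
  imports Complex_Main
begin

text \<open>
  A complex vector space is the whole type \<open>'a\<close> with scalar multiplication
  \<open>scale :: complex \<Rightarrow> 'a \<Rightarrow> 'a\<close>; a product or bracket is a curried function on \<open>'a\<close>.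
  The library predicate \<^const>\<open>Vector_Spaces.linear\<close> includes the vector space axioms for
  domain and codomain, so every structure below lives on a vector space.
\<close>

definition bilinear_map ::
  "(complex \<Rightarrow> 'a::ab_group_add \<Rightarrow> 'a) \<Rightarrow> (complex \<Rightarrow> 'b::ab_group_add \<Rightarrow> 'b)
    \<Rightarrow> ('a \<Rightarrow> 'a \<Rightarrow> 'b) \<Rightarrow> bool"
  where "bilinear_map scale scale' f \<longleftrightarrow>
    (\<forall>x. Vector_Spaces.linear scale scale' (f x)) \<and>
    (\<forall>y. Vector_Spaces.linear scale scale' (\<lambda>x. f x y))"

definition commutator :: "('a::ab_group_add \<Rightarrow> 'a \<Rightarrow> 'a) \<Rightarrow> 'a \<Rightarrow> 'a \<Rightarrow> 'a"
  where "commutator m x y = m x y - m y x"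

definition op_comb ::
  "(complex \<Rightarrow> 'a::ab_group_add \<Rightarrow> 'a) \<Rightarrow> complex \<Rightarrow> ('a \<Rightarrow> 'a \<Rightarrow> 'a)
    \<Rightarrow> complex \<Rightarrow> ('a \<Rightarrow> 'a \<Rightarrow> 'a) \<Rightarrow> 'a \<Rightarrow> 'a \<Rightarrow> 'a"
  where "op_comb scale k1 f k2 g x y = scale k1 (f x y) + scale k2 (g x y)"

definition anti_pre_Lie ::
  "(complex \<Rightarrow> 'a::ab_group_add \<Rightarrow> 'a) \<Rightarrow> ('a \<Rightarrow> 'a \<Rightarrow> 'a) \<Rightarrow> bool"
  where "anti_pre_Lie scale m \<longleftrightarrow>
    bilinear_map scale scale m \<and>
    (\<forall>x y z. m x (m y z) - m y (m x z) = m (commutator m y x) z) \<and>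
    (\<forall>x y z. m (commutator m x y) z + m (commutator m y z) x + m (commutator m z x) y = 0)"

definition compatible_anti_pre_Lie ::
  "(complex \<Rightarrow> 'a::ab_group_add \<Rightarrow> 'a) \<Rightarrow> ('a \<Rightarrow> 'a \<Rightarrow> 'a) \<Rightarrow> ('a \<Rightarrow> 'a \<Rightarrow> 'a) \<Rightarrow> bool"
  where "compatible_anti_pre_Lie scale circ ast \<longleftrightarrow>
    anti_pre_Lie scale circ \<and> anti_pre_Lie scale ast \<and>
    (\<forall>k1 k2. anti_pre_Lie scale (op_comb scale k1 circ k2 ast))"

definition Lie_bracket ::
  "(complex \<Rightarrow> 'a::ab_group_add \<Rightarrow> 'a) \<Rightarrow> ('a \<Rightarrow> 'a \<Rightarrow> 'a) \<Rightarrow> bool"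
  where "Lie_bracket scale br \<longleftrightarrow>
    bilinear_map scale scale br \<and>
    (\<forall>x. br x x = 0) \<and>
    (\<forall>x y z. br x (br y z) + br y (br z x) + br z (br x y) = 0)"

definition compatible_Lie ::
  "(complex \<Rightarrow> 'a::ab_group_add \<Rightarrow> 'a) \<Rightarrow> ('a \<Rightarrow> 'a \<Rightarrow> 'a) \<Rightarrow> ('a \<Rightarrow> 'a \<Rightarrow> 'a) \<Rightarrow> bool"
  where "compatible_Lie scale br1 br2 \<longleftrightarrow>
    Lie_bracket scale br1 \<and> Lie_bracket scale br2 \<and>
    (\<forall>k1 k2. Lie_bracket scale (op_comb scale k1 br1 k2 br2))"

definition compatible_anti_pre_Lie_structure_on ::
  "(complex \<Rightarrow> 'a::ab_group_add \<Rightarrow> 'a) \<Rightarrow> ('a \<Rightarrow> 'a \<Rightarrow> 'a) \<Rightarrow> ('a \<Rightarrow> 'a \<Rightarrow> 'a)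
    \<Rightarrow> ('a \<Rightarrow> 'a \<Rightarrow> 'a) \<Rightarrow> ('a \<Rightarrow> 'a \<Rightarrow> 'a) \<Rightarrow> bool"
  where "compatible_anti_pre_Lie_structure_on scale br1 br2 circ ast \<longleftrightarrow>
    compatible_anti_pre_Lie scale circ ast \<and>
    (\<forall>x y. br1 x y = commutator circ x y) \<and>
    (\<forall>x y. br2 x y = commutator ast x y)"

definition symmetric_bilinear_form ::
  "(complex \<Rightarrow> 'a::ab_group_add \<Rightarrow> 'a) \<Rightarrow> ('a \<Rightarrow> 'a \<Rightarrow> complex) \<Rightarrow> bool"
  where "symmetric_bilinear_form scale B \<longleftrightarrow>
    bilinear_map scale (*) B \<and> (\<forall>x y. B x y = B y x)"

text \<open>Only the left radical is required to vanish; for the symmetric forms considered here it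
  coincides with the right radical.\<close>

definition nondegenerate :: "('a::ab_group_add \<Rightarrow> 'a \<Rightarrow> complex) \<Rightarrow> bool"
  where "nondegenerate B \<longleftrightarrow> (\<forall>x. (\<forall>y. B x y = 0) \<longrightarrow> x = 0)"

definition commutative_2_cocycle ::
  "(complex \<Rightarrow> 'a::ab_group_add \<Rightarrow> 'a) \<Rightarrow> ('a \<Rightarrow> 'a \<Rightarrow> 'a) \<Rightarrow> ('a \<Rightarrow> 'a \<Rightarrow> complex) \<Rightarrow> bool"
  where "commutative_2_cocycle scale br B \<longleftrightarrow>
    symmetric_bilinear_form scale B \<and>
    (\<forall>x y z. B (br x y) z + B (br y z) x + B (br z x) y = 0)"

definition compatible_commutative_2_cocycle ::
  "(complex \<Rightarrow> 'a::ab_group_add \<Rightarrow> 'a) \<Rightarrow> ('a \<Rightarrow> 'a \<Rightarrow> 'a) \<Rightarrow> ('a \<Rightarrow> 'a \<Rightarrow> 'a)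
    \<Rightarrow> ('a \<Rightarrow> 'a \<Rightarrow> complex) \<Rightarrow> bool"
  where "compatible_commutative_2_cocycle scale br1 br2 B \<longleftrightarrow>
    symmetric_bilinear_form scale B \<and>
    (\<forall>k1 k2. commutative_2_cocycle scale (op_comb scale k1 br1 k2 br2) B)"

end

theory Submission
  imports Defs
begin

text \<open>
  Multiplication from the left by \<open>x\<close> in either product is the \<open>B\<close>-adjoint of bracketing with
  \<open>x\<close>. Since \<open>B\<close> is nondegenerate and the space is finite-dimensional, the linear functional
  \<open>z \<mapsto> B y [x, z]\<close> is represented by exactly one vector, which is taken as \<open>x \<cdot> y\<close>
  (\<open>functional_represented\<close>).

  Everything else concerns one bracket at a time and is checked by pairing with an arbitrary vector
  (\<open>anti_pre_Lie_of_cocycle\<close>).  The commutator of the product is the bracket precisely by the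
  cocycle identity.  Because taking adjoints reverses composition, the first anti-pre-Lie
  identity is the Jacobi identity read through \<open>B\<close>.  The second says that the sum of
  \<open>B z [[x, y], w]\<close> over the cyclic permutations of \<open>x\<close>, \<open>y\<close>, \<open>z\<close> vanishes;
  the cocycle identity expresses this sum in two ways through the cyclic sum of \<open>B [x, z] [y, w]\<close>, with opposite signs.

  Compatibility costs nothing more: the relation defining the products is linear in the
  bracket, so a linear combination of the two products is attached to the same combination of
  the brackets, and this combination is again a Lie bracket for which \<open>B\<close> is a cocycle.
\<close>

section \<open>Nondegenerate bilinear forms\<close>

lemma bilinear_mapD:
  assumes "bilinear_map s s' f"
  shows "f (x + y) z = f x z + f y z" "f x (y + z) = f x y + f x z"
    and "f (s c x) z = s' c (f x z)" "f x (s c z) = s' c (f x z)"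
  using assms by (auto simp: bilinear_map_def Vector_Spaces.linear_iff)

lemma bilinear_map_zero_minus:
  assumes "bilinear_map s s' f"
  shows "f 0 z = 0" "f x 0 = 0" "f (- x) z = - f x z" "f x (- z) = - f x z"
    and "f (x - y) z = f x z - f y z" "f x (y - z) = f x y - f x z"
proof -
  note add = bilinear_mapD(1,2)[OF assms]
  show zero: "f 0 z = 0" "f x 0 = 0" for x z
    using add(1)[of 0 0 z] add(2)[of x 0 0] by simp_all
  show minus: "f (- x) z = - f x z" "f x (- z) = - f x z" for x z
    using add(1)[of x "- x" z] add(2)[of x z "- z"] zero
    by (simp_all add: eq_neg_iff_add_eq_0 add.commute)
  show "f (x - y) z = f x z - f y z" "f x (y - z) = f x y - f x z"
    using add(1)[of x "- y" z] add(2)[of x y "- z"] minus by simp_all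
qed

lemma nondegenerate_eqI:
  assumes "bilinear_map s (*) B" "nondegenerate B" "\<And>z. B x z = B y z"
  shows "x = y"
proof -
  have "B (x - y) z = 0" for z
    using assms(3) by (simp add: bilinear_map_zero_minus[OF assms(1)])
  then have "x - y = 0"
    using assms(2) unfolding nondegenerate_def by blast
  then show ?thesis by simp
qed

text \<open>
  Nondegeneracy makes \<open>v \<mapsto> B v\<close> an injection into the dual space, so a dimension count makes
  it onto.  Coordinates with respect to the basis identify the dual with the space itself, which
  turns the count into the fact that an injective endomorphism is surjective.
\<close>

lemma functional_represented:
  assumes fd: "finite_dimensional_vector_space scale Basis"
    and bil: "bilinear_map scale (*) B" and nd: "nondegenerate B"
    and g: "Vector_Spaces.linear scale (*) g"
  shows "\<exists>v. \<forall>z. B v z = g z"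
proof -
  interpret finite_dimensional_vector_space scale Basis by (fact fd)
  note bilD = bilinear_mapD[OF bil]
  have lin_B: "Vector_Spaces.linear scale (*) (B v)" for v
    using bil by (simp add: bilinear_map_def)
  have vs: "vector_space scale" by unfold_locales
  interpret pair: vector_space_pair scale "(*) :: complex \<Rightarrow> complex \<Rightarrow> complex"
    using g by (simp add: vector_space_pair_def Vector_Spaces.linear_iff)
  have eq_if_eq_on_Basis: "p z = q z"
    if "Vector_Spaces.linear scale (*) p" "Vector_Spaces.linear scale (*) q"
      "\<And>b. b \<in> Basis \<Longrightarrow> p b = q b" for p q z
    using pair.linear_eq_on[OF that(1,2), of z Basis] that(3) by (simp add: span_Basis)
  define T where "T v = (\<Sum>b\<in>Basis. scale (B v b) b)" for v
  have coords: "u b = w b"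
    if "(\<Sum>b\<in>Basis. scale (u b) b) = (\<Sum>b\<in>Basis. scale (w b) b)" "b \<in> Basis" for u w b
  proof -
    have "(\<Sum>b\<in>Basis. scale (u b - w b) b) = 0"
      using that(1) by (simp add: scale_left_diff_distrib sum_subtractf)
    from independentD[OF independent_Basis finite_Basis order_refl this that(2)]
    show ?thesis by simp
  qed
  have "Vector_Spaces.linear scale scale T"
    using vs by (simp add: Vector_Spaces.linear_iff T_def bilD scale_left_distrib sum.distrib
        scale_sum_right)
  moreover have "inj T"
  proof (rule injI)
    fix v w assume "T v = T w"
    then have "B v b = B w b" if "b \<in> Basis" for b
      using that coords[of "B v" "B w" b] by (simp add: T_def)
    then have "B v z = B w z" for z
      by (rule eq_if_eq_on_Basis[OF lin_B lin_B])
    then show "v = w"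
      by (rule nondegenerate_eqI[OF bil nd])
  qed
  ultimately have "surj T"
    by (rule linear_inj_imp_surj)
  then obtain v where "T v = (\<Sum>b\<in>Basis. scale (g b) b)"
    by (metis surjD)
  then have "B v b = g b" if "b \<in> Basis" for b
    using that coords[of "B v" g b] by (simp add: T_def)
  then have "B v z = g z" for z
    by (rule eq_if_eq_on_Basis[OF lin_B g])
  then show ?thesis by blast
qed

section \<open>The product attached to a commutative 2-cocycle\<close>

lemma adjoint_product_exists:
  assumes fd: "finite_dimensional_vector_space scale Basis"
    and B: "bilinear_map scale (*) B" "nondegenerate B"
    and br: "bilinear_map scale scale br"
  shows "\<exists>m. \<forall>x y z. B (m x y) z = B y (br x z)"
proof -
  have "Vector_Spaces.linear scale (*) (\<lambda>z. B y (br x z))" for x y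
  proof -
    have "vector_space scale" "vector_space ((*) :: complex \<Rightarrow> complex \<Rightarrow> complex)"
      using B(1) by (auto simp: bilinear_map_def Vector_Spaces.linear_iff)
    then show ?thesis
      by (simp add: Vector_Spaces.linear_iff bilinear_mapD[OF B(1)] bilinear_mapD[OF br])
  qed
  then have "\<forall>x y. \<exists>v. \<forall>z. B v z = B y (br x z)"
    using functional_represented[OF fd B] by blast
  then show ?thesis by metis
qed

text \<open>
  The equation for the product determines it by nondegeneracy, so every identity, bilinearity
  included, is tested by pairing both sides with an arbitrary vector and moving the products over
  to brackets in the second argument.  For the second anti-pre-Lie identity the outcome is a
  complex number that equals its own negative.
\<close>

lemma anti_pre_Lie_of_cocycle:
  assumes lie: "Lie_bracket scale br"
    and coc: "commutative_2_cocycle scale br B"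
    and nd: "nondegenerate B"
    and m: "\<And>x y z. B (m x y) z = B y (br x z)"
  shows "anti_pre_Lie scale m" and "commutator m = br"
proof -
  have bil: "bilinear_map scale (*) B" and sym: "\<And>x y. B x y = B y x"
    and cyc: "\<And>x y z. B (br x y) z + B (br y z) x + B (br z x) y = 0"
    using coc by (auto simp: commutative_2_cocycle_def symmetric_bilinear_form_def)
  have bilbr: "bilinear_map scale scale br" and alt: "\<And>x. br x x = 0"
    and jac: "\<And>x y z. br x (br y z) + br y (br z x) + br z (br x y) = 0"
    using lie by (auto simp: Lie_bracket_def)
  have vs: "vector_space scale"
    using bilbr by (simp add: bilinear_map_def Vector_Spaces.linear_iff)
  note BD = bilinear_mapD[OF bil] bilinear_map_zero_minus[OF bil]
  note brD = bilinear_mapD[OF bilbr] bilinear_map_zero_minus[OF bilbr]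
  note eqI = nondegenerate_eqI[OF bil nd]
  have anti: "br y x = - br x y" for x y
  proof -
    have "br (x + y) (x + y) = 0" by (rule alt)
    then have "br x y + br y x = 0"
      unfolding brD(1,2) by (simp add: alt add.commute)
    then show ?thesis by (rule minus_unique[symmetric])
  qed
  have jacobi: "br (br x y) z = br x (br y z) - br y (br x z)" for x y z
  proof -
    have "br y (br z x) = - br y (br x z)"
      by (simp add: anti[of z x] brD)
    moreover have "br z (br x y) = - br (br x y) z"
      by (rule anti)
    ultimately have "br x (br y z) - br y (br x z) - br (br x y) z = 0"
      using jac[of x y z] by simp
    then show ?thesis by simp
  qed

  have comm: "commutator m x y = br x y" for x y
  proof (rule eqI)
    fix z
    show "B (commutator m x y) z = B (br x y) z"
    proof -
      have "B (br z x) y = - B y (br x z)"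
        by (simp add: anti[of z x] BD sym[of y])
      then show ?thesis
        using cyc[of x y z] unfolding commutator_def BD m sym[of x "br y z"] by algebra
    qed
  qed
  then show "commutator m = br" by blast

  have "bilinear_map scale scale m"
  proof -
    have "m x (y + z) = m x y + m x z" "m (x + y) z = m x z + m y z"
      "m x (scale c z) = scale c (m x z)" "m (scale c x) z = scale c (m x z)" for x y z c
      by (rule eqI; simp add: BD brD m)+
    then show ?thesis
      using vs by (simp add: bilinear_map_def Vector_Spaces.linear_iff)
  qed
  moreover have "m x (m y z) - m y (m x z) = m (commutator m y x) z" for x y z
    by (rule eqI) (simp add: comm BD m jacobi)
  moreover have "m (commutator m x y) z + m (commutator m y z) x + m (commutator m z x) y = 0"
    for x y z
  proof (rule eqI)
    fix w
    let ?S = "B z (br (br x y) w) + B x (br (br y z) w) + B y (br (br z x) w)"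
    let ?P = "B (br x z) (br y w) + B (br y x) (br z w) + B (br z y) (br x w)"
    \<comment> \<open>Jacobi splits each double bracket in two; the six terms pair into three cocycle identities.\<close>
    have step: "B c (br a (br b w)) - B a (br c (br b w)) = B (br a c) (br b w)" for a b c
    proof -
      have "B (br (br b w) c) a = - B a (br c (br b w))" "B (br c a) (br b w) = - B (br a c) (br b w)"
        by (simp_all add: anti[of c] BD sym[of a])
      then show ?thesis
        using cyc[of a "br b w" c] sym[of c "br a (br b w)"] by algebra
    qed
    have "?S = ?P"
      unfolding jacobi[of _ _ w] BD step[symmetric] by simp
    \<comment> \<open>Applying the cocycle identity before splitting leaves terms that cancel by Jacobi.\<close>
    moreover have "?S = - ?P"
    proof -
      have shift: "B c (br (br a b) w) = B (br c w) (br a b) - B (br c (br a b)) w" for a b c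
      proof -
        have "B (br w c) (br a b) = - B (br c w) (br a b)"
          by (simp add: anti[of c w] BD)
        then show ?thesis
          using cyc[of "br a b" w c] sym[of c "br (br a b) w"] by algebra
      qed
      have "B (br x (br y z)) w + B (br y (br z x)) w + B (br z (br x y)) w = 0"
        using arg_cong[OF jac[of x y z], of "\<lambda>v. B v w"] by (simp add: BD)
      moreover have "?S = B (br z w) (br x y) + B (br x w) (br y z) + B (br y w) (br z x)
          - (B (br x (br y z)) w + B (br y (br z x)) w + B (br z (br x y)) w)"
        unfolding shift by simp
      moreover have "B (br a c) (br b w) = - B (br b w) (br c a)" for a b c
        by (simp add: anti[of c a] BD sym[of "br b w"])
      ultimately show ?thesis by simp
    qed
    moreover have "u = 0" if "u = v" "u = - v" for u v :: complex
      using that by (metis eq_neg_iff_add_eq_0 mult_2 mult_eq_0_iff zero_neq_numeral)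
    ultimately have "?S = 0" by blast
    then show "B (m (commutator m x y) z + m (commutator m y z) x + m (commutator m z x) y) w
        = B 0 w"
      by (simp add: comm BD m)
  qed
  ultimately show "anti_pre_Lie scale m"
    by (simp add: anti_pre_Lie_def)
qed

section \<open>Compatible structures\<close>

theorem theorem4p3:
  fixes scale :: "complex \<Rightarrow> 'a::ab_group_add \<Rightarrow> 'a"
    and Basis :: "'a set"
    and br1 br2 :: "'a \<Rightarrow> 'a \<Rightarrow> 'a"
    and B :: "'a \<Rightarrow> 'a \<Rightarrow> complex"
  assumes "finite_dimensional_vector_space scale Basis"
    and "compatible_Lie scale br1 br2"
    and "compatible_commutative_2_cocycle scale br1 br2 B"
    and "nondegenerate B"
  shows "\<exists>circ ast :: 'a \<Rightarrow> 'a \<Rightarrow> 'a.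
    compatible_anti_pre_Lie_structure_on scale br1 br2 circ ast \<and>
    (\<forall>x y z. B (circ x y) z = B y (br1 x z)) \<and>
    (\<forall>x y z. B (ast x y) z = B y (br2 x z))"
proof -
  have B: "bilinear_map scale (*) B"
    and coc: "\<And>k1 k2. commutative_2_cocycle scale (op_comb scale k1 br1 k2 br2) B"
    using assms(3)
    by (auto simp: compatible_commutative_2_cocycle_def symmetric_bilinear_form_def)
  have lie: "Lie_bracket scale br1" "Lie_bracket scale br2"
    "\<And>k1 k2. Lie_bracket scale (op_comb scale k1 br1 k2 br2)"
    using assms(2) by (auto simp: compatible_Lie_def)
  have bil: "bilinear_map scale scale br1" "bilinear_map scale scale br2"
    using lie(1,2) by (auto simp: Lie_bracket_def)
  interpret finite_dimensional_vector_space scale Basis by (fact assms(1))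
  \<comment> \<open>The single brackets are the combinations with coefficients \<open>(1, 0)\<close> and \<open>(0, 1)\<close>.\<close>
  have coc1: "commutative_2_cocycle scale br1 B" and coc2: "commutative_2_cocycle scale br2 B"
    using coc[of 1 0] coc[of 0 1] by (simp_all add: op_comb_def[abs_def])
  obtain circ where circ: "\<And>x y z. B (circ x y) z = B y (br1 x z)"
    using adjoint_product_exists[OF assms(1) B assms(4) bil(1)] by blast
  obtain ast where ast: "\<And>x y z. B (ast x y) z = B y (br2 x z)"
    using adjoint_product_exists[OF assms(1) B assms(4) bil(2)] by blast
  have "B (op_comb scale k1 circ k2 ast x y) z = B y (op_comb scale k1 br1 k2 br2 x z)"
    for k1 k2 x y z
    by (simp add: op_comb_def bilinear_mapD[OF B] circ ast)
  then have "anti_pre_Lie scale (op_comb scale k1 circ k2 ast)" for k1 k2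
    by (rule anti_pre_Lie_of_cocycle(1)[OF lie(3) coc assms(4)])
  moreover have "anti_pre_Lie scale circ" "commutator circ = br1"
    using anti_pre_Lie_of_cocycle[where m = circ, OF lie(1) coc1 assms(4)] circ by simp_all
  moreover have "anti_pre_Lie scale ast" "commutator ast = br2"
    using anti_pre_Lie_of_cocycle[where m = ast, OF lie(2) coc2 assms(4)] ast by simp_all
  ultimately have "compatible_anti_pre_Lie_structure_on scale br1 br2 circ ast"
    by (simp add: compatible_anti_pre_Lie_structure_on_def compatible_anti_pre_Lie_def)
  then show ?thesis
    using circ ast by (intro exI[of _ circ] exI[of _ ast] conjI allI)
qed

end
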